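(* Let $(X,d)$ be a metric space. For $u,v\in P^1_{USC}(X)$: (i) $H_{\rm end}(u,v)\le H_{\rm send}(u,v)$; (ii) $H(\langle u\rangle_0,\langle v\rangle_0)\le H_{\rm send}(u,v)$; (iii) if $H_{\rm end}(u,v)<1$, then $H_{\rm send}(u,v)\le H_{\rm end}(u,v)+H(\langle u\rangle_0,\langle v\rangle_0)$. For a sequence $\{u_n\}$ in $P^1_{USC}(X)$ and $u$ in $P^1_{USC}(X)$: (iv) $H_{\rm send}(u_n,u)\to0$ if and only if $H_{\rm end}(u_n,u)\to0$ and $H(\langle u_n\rangle_0,\langle u\rangle_0)\to0$; (v) $\lim^{(K)}_{n\to\infty}u_n=u$ if and only if $\lim^{(K)}_{n\to\infty}\underline{u_n}=\underline u$ and $\lim^{(K)}_{n\to\infty}\langle u_n\rangle_0=\langle u\rangle_0$.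
   Context: $(X,d)$ is a nonempty metric space. $X\times[0,1]$ carries the metric $\overline d((x,\alpha),(y,\beta))=d(x,y)+|\alpha-\beta|$. $C(Y)$ is the set of nonempty closed subsets of a metric space $Y$. For nonempty closed sets $A,B$, $H(A,B)=\max\{\sup_{a\in A}\inf_{b\in B}\rho(a,b),\sup_{b\in B}\inf_{a\in A}\rho(a,b)\}\in[0,+\infty]$ is the Hausdorff distance, with $\rho=d$ on $X$ and $\rho=\overline d$ on $X\times[0,1]$. For $u\subseteq X\times[0,1]$ and $\alpha\in[0,1]$, $\langle u\rangle_\alpha=\{x:(x,\alpha)\in u\}$, and $\underline u=u\cup(X\times\{0\})$. $P^1_{USC}(X)$ is the set of $u\subseteq X\times[0,1]$ such that $\langle u\rangle_\alpha\in C(X)$ for all $\alpha\in[0,1]$ and $\langle u\rangle_\alpha=\bigcap_{\beta<\alpha}\langle u\rangle_\beta$ for all $\alpha\in(0,1]$ (here $\beta\in[0,\alpha)$); such $u$ are closed in $X\times[0,1]$. For $u,v\in P^1_{USC}(X)$: $H_{\rm send}(u,v)=H(u,v)$ and $H_{\rm end}(u,v)=H(\underline u,\underline v)$ (both computed with $\overline d$). A sequence of sets $\{C_n\}$ in a metric space $Y$ Kuratowski converges to $C\subseteq Y$, written $C=\lim^{(K)}_{n\to\infty}C_n$, if $C=\liminf_{n\to\infty}C_n=\limsup_{n\to\infty}C_n$, where $\liminf_n C_n=\{x\in Y: x=\lim_n x_n,\ x_n\in C_n\}$ and $\limsup_n C_n=\{x\in Y: x=\lim_j x_{n_j},\ x_{n_j}\in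 C_{n_j}\text{ for some subsequence}\}=\bigcap_{n\ge1}\overline{\bigcup_{m\ge n}C_m}$. *)

theory Defs
  imports "HOL-Analysis.Analysis"
begin

text \<open>
  A metric space is a carrier set with a distance function, in the sense of the library locale
  \<^locale>\<open>Metric_space\<close>.
\<close>

definition dbar :: "('a \<Rightarrow> 'a \<Rightarrow> real) \<Rightarrow> 'a \<times> real \<Rightarrow> 'a \<times> real \<Rightarrow> real" where
  "dbar d p q = d (fst p) (fst q) + \<bar>snd p - snd q\<bar>"

lemma Metric_space_dbar:
  assumes "Metric_space X d"
  shows "Metric_space (X \<times> {0..1}) (dbar d)"
proof -
  interpret Metric_space X d by fact
  show ?thesis
  proof
    show "0 \<le> dbar d p q" for p q
      by (simp add: dbar_def)
    show "dbar d p q = dbar d q p" for p q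
      by (simp add: dbar_def commute abs_minus_commute)
    show "dbar d p q = 0 \<longleftrightarrow> p = q" if "p \<in> X \<times> {0..1}" "q \<in> X \<times> {0..1}" for p q
      using that by (auto simp: dbar_def add_nonneg_eq_0_iff)
    show "dbar d p r \<le> dbar d p q + dbar d q r"
      if "p \<in> X \<times> {0..1}" "q \<in> X \<times> {0..1}" "r \<in> X \<times> {0..1}" for p q r
    proof -
      have "d (fst p) (fst r) \<le> d (fst p) (fst q) + d (fst q) (fst r)"
        using that by (intro triangle) auto
      then show ?thesis
        by (simp add: dbar_def)
    qed
  qed
qed

definition nonempty_closed :: "'b set \<Rightarrow> ('b \<Rightarrow> 'b \<Rightarrow> real) \<Rightarrow> 'b set set" where
  "nonempty_closed Y \<rho> = {A. A \<noteq> {} \<and> closedin (Metric_space.mtopology Y \<rho>) A}"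

text \<open>
  The value \<^term>\<open>\<infinity> :: ennreal\<close> is allowed. The definition is meant for nonempty sets only:
  in \<^typ>\<open>ennreal\<close> the supremum over the empty set is 0 and the infimum over it is infinite.
\<close>
definition hausdorff :: "('b \<Rightarrow> 'b \<Rightarrow> real) \<Rightarrow> 'b set \<Rightarrow> 'b set \<Rightarrow> ennreal" where
  "hausdorff \<rho> A B =
     max (SUP a\<in>A. INF b\<in>B. ennreal (\<rho> a b)) (SUP b\<in>B. INF a\<in>A. ennreal (\<rho> a b))"

definition level_cut :: "('a \<times> real) set \<Rightarrow> real \<Rightarrow> 'a set" where
  "level_cut u \<alpha> = {x. (x, \<alpha>) \<in> u}"

definition underline :: "'a set \<Rightarrow> ('a \<times> real) set \<Rightarrow> ('a \<times> real) set" where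
  "underline X u = u \<union> X \<times> {0}"

definition P1_USC :: "'a set \<Rightarrow> ('a \<Rightarrow> 'a \<Rightarrow> real) \<Rightarrow> ('a \<times> real) set set" where
  "P1_USC X d = {u. u \<subseteq> X \<times> {0..1} \<and>
     (\<forall>\<alpha>\<in>{0..1}. level_cut u \<alpha> \<in> nonempty_closed X d) \<and>
     (\<forall>\<alpha>\<in>{0<..1}. level_cut u \<alpha> = (\<Inter>\<beta>\<in>{0..<\<alpha>}. level_cut u \<beta>))}"

definition H_send :: "('a \<Rightarrow> 'a \<Rightarrow> real) \<Rightarrow> ('a \<times> real) set \<Rightarrow> ('a \<times> real) set \<Rightarrow> ennreal" where
  "H_send d u v = hausdorff (dbar d) u v"

definition H_end :: "'a set \<Rightarrow> ('a \<Rightarrow> 'a \<Rightarrow> real) \<Rightarrow> ('a \<times> real) set \<Rightarrow> ('a \<times> real) set \<Rightarrow> ennreal" where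
  "H_end X d u v = hausdorff (dbar d) (underline X u) (underline X v)"

text \<open>
  Limit points are taken in the carrier \<^term>\<open>Y\<close>: \<^const>\<open>limitin\<close> requires the limit to lie in
  the underlying set of the topology.
\<close>
definition K_liminf :: "'b set \<Rightarrow> ('b \<Rightarrow> 'b \<Rightarrow> real) \<Rightarrow> (nat \<Rightarrow> 'b set) \<Rightarrow> 'b set" where
  "K_liminf Y \<rho> C =
     {x. \<exists>s. (\<forall>n. s n \<in> C n) \<and> limitin (Metric_space.mtopology Y \<rho>) s x sequentially}"

definition K_limsup :: "'b set \<Rightarrow> ('b \<Rightarrow> 'b \<Rightarrow> real) \<Rightarrow> (nat \<Rightarrow> 'b set) \<Rightarrow> 'b set" where
  "K_limsup Y \<rho> C =
     {x. \<exists>r s. strict_mono r \<and> (\<forall>j::nat. s j \<in> C (r j)) \<and>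
           limitin (Metric_space.mtopology Y \<rho>) s x sequentially}"

definition K_converges :: "'b set \<Rightarrow> ('b \<Rightarrow> 'b \<Rightarrow> real) \<Rightarrow> (nat \<Rightarrow> 'b set) \<Rightarrow> 'b set \<Rightarrow> bool" where
  "K_converges Y \<rho> C L \<longleftrightarrow> L = K_liminf Y \<rho> C \<and> L = K_limsup Y \<rho> C"

end

theory Submission
  imports Defs
begin

text \<open>
  A set \<open>u\<close> in \<^const>\<open>P1_USC\<close> lies over its bottom cut: if \<open>(x, \<alpha>) \<in> u\<close> then \<open>(x, 0) \<in> u\<close>.
  Passing from \<open>u\<close> to \<^term>\<open>underline X u\<close> only adds points at height \<open>0\<close>, so \<open>u\<close> and
  \<^term>\<open>underline X u\<close> are indistinguishable at positive height, and what the endograph forgets is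
  exactly the bottom cut. All five claims are versions of this remark.

  For the distances, the nearest point of \<open>X \<times> {0}\<close> to \<open>(x, \<alpha>)\<close> is \<open>(x, 0)\<close>, at distance
  \<open>\<alpha>\<close>. Hence the distance from \<open>(x, \<alpha>)\<close> to \<^term>\<open>underline X v\<close> is the minimum of \<open>\<alpha>\<close> and its
  distance to \<open>v\<close>. If the minimum is attained by the latter, the endograph distance controls the
  distance to \<open>v\<close>. Otherwise it controls \<open>\<alpha>\<close>, and one reaches \<open>v\<close> by descending to height \<open>0\<close>
  and moving inside \<open>X\<close> to the bottom cut of \<open>v\<close>, which costs at most \<open>\<alpha>\<close> plus the distance of the
  bottom cuts (\<open>excess_send_le\<close>). The statement on sequences of distances follows by squeezing.

  For Kuratowski convergence, limits in \<open>X \<times> [0,1]\<close> are taken coordinatewise. A sequence in the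
  endographs whose limit has positive height eventually avoids height \<open>0\<close> and so is eventually in
  the sets themselves. A limit at height \<open>0\<close> of points of the sets is the limit of their
  projections, which lie in the bottom cuts.
\<close>

section \<open>Sets lying over their bottom cut\<close>

lemma P1_USC_subset: "u \<in> P1_USC X d \<Longrightarrow> u \<subseteq> X \<times> {0..1}"
  by (simp add: P1_USC_def)

lemma P1_USC_cut_nonempty: "u \<in> P1_USC X d \<Longrightarrow> level_cut u 0 \<noteq> {}"
  by (auto simp: P1_USC_def nonempty_closed_def)

lemma level_cut_zero_subset: "u \<subseteq> X \<times> {0..1} \<Longrightarrow> level_cut u 0 \<subseteq> X"
  by (auto simp: level_cut_def)

text \<open>
  The intersection formula for a cut at positive height has \<open>\<beta> = 0\<close> among its indices.
\<close>
lemma P1_USC_fst_subset_cut: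
  assumes "u \<in> P1_USC X d"
  shows "fst ` u \<subseteq> level_cut u 0"
proof clarsimp
  fix x \<alpha> assume xu: "(x, \<alpha>) \<in> u"
  then have "\<alpha> = 0 \<or> \<alpha> \<in> {0<..1}"
    using P1_USC_subset[OF assms] by force
  then show "x \<in> level_cut u 0"
  proof
    assume \<alpha>: "\<alpha> \<in> {0<..1}"
    then have "level_cut u \<alpha> = (\<Inter>\<beta>\<in>{0..<\<alpha>}. level_cut u \<beta>)"
      using assms by (simp add: P1_USC_def)
    moreover have "x \<in> level_cut u \<alpha>"
      using xu by (simp add: level_cut_def)
    ultimately show ?thesis
      using \<alpha> by auto
  qed (use xu in \<open>simp add: level_cut_def\<close>)
qed

section \<open>One-sided Hausdorff distances\<close>

definition excess :: "('b \<Rightarrow> 'b \<Rightarrow> real) \<Rightarrow> 'b set \<Rightarrow> 'b set \<Rightarrow> ennreal" where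
  "excess \<rho> A B = (SUP a\<in>A. INF b\<in>B. ennreal (\<rho> a b))"

lemma hausdorff_eq_max_excess:
  assumes "\<And>p q. \<rho> p q = \<rho> q p"
  shows "hausdorff \<rho> A B = max (excess \<rho> A B) (excess \<rho> B A)"
  unfolding hausdorff_def excess_def by (subst (2) assms) (rule refl)

lemma INF_le_excess: "a \<in> A \<Longrightarrow> (INF b\<in>B. ennreal (\<rho> a b)) \<le> excess \<rho> A B"
  unfolding excess_def by (rule SUP_upper)

text \<open>
  The points added to the first set belong to the enlarged second set, so they have distance \<open>0\<close>
  from it.
\<close>
lemma excess_end_le_send:
  assumes "Metric_space X d"
  shows "excess (dbar d) (underline X u) (underline X v) \<le> excess (dbar d) u v"
  unfolding excess_def[of _ "underline X u"]
proof (rule SUP_least)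
  interpret Metric_space X d by fact
  fix p assume "p \<in> underline X u"
  then consider "p \<in> u" | "p \<in> X \<times> {0}"
    by (auto simp: underline_def)
  then show "(INF q\<in>underline X v. ennreal (dbar d p q)) \<le> excess (dbar d) u v"
  proof cases
    case 1
    have "(INF q\<in>underline X v. ennreal (dbar d p q)) \<le> (INF q\<in>v. ennreal (dbar d p q))"
      by (rule INF_superset_mono) (auto simp: underline_def)
    then show ?thesis
      using INF_le_excess[OF 1] order_trans by blast
  next
    case 2
    then have "(INF q\<in>underline X v. ennreal (dbar d p q)) \<le> ennreal (dbar d p p)"
      by (intro INF_lower) (simp add: underline_def)
    also have "dbar d p p = 0"
      using 2 by (auto simp: dbar_def)
    finally show ?thesis
      by simp
  qed
qed

text \<open>Projecting to \<open>X\<close> shortens distances and sends \<open>v\<close> into its bottom cut.\<close>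
lemma excess_cut_le_send:
  assumes "fst ` v \<subseteq> level_cut v 0"
  shows "excess d (level_cut u 0) (level_cut v 0) \<le> excess (dbar d) u v"
  unfolding excess_def[of d]
proof (rule SUP_least)
  fix x assume "x \<in> level_cut u 0"
  then have xu: "(x, 0) \<in> u"
    by (simp add: level_cut_def)
  have "(INF y\<in>level_cut v 0. ennreal (d x y)) \<le> (INF q\<in>v. ennreal (dbar d (x, 0) q))"
  proof (rule INF_mono)
    fix q assume "q \<in> v"
    then have "fst q \<in> level_cut v 0"
      using assms by blast
    then show "\<exists>y\<in>level_cut v 0. ennreal (d x y) \<le> ennreal (dbar d (x, 0) q)"
      by (rule rev_bexI) (auto simp: dbar_def intro!: ennreal_leI)
  qed
  then show "(INF y\<in>level_cut v 0. ennreal (d x y)) \<le> excess (dbar d) u v"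
    using INF_le_excess[OF xu] order_trans by blast
qed

text \<open>
  Either the endograph excess already dominates the distance from a point of \<open>u\<close> to \<open>v\<close>, or it
  dominates the height of that point, and then the route through height \<open>0\<close> is short enough.
\<close>
lemma excess_send_le:
  assumes "Metric_space X d" and "u \<subseteq> X \<times> {0..1}" and "fst ` u \<subseteq> level_cut u 0"
  shows "excess (dbar d) u v \<le>
    excess (dbar d) (underline X u) (underline X v) + excess d (level_cut u 0) (level_cut v 0)"
    (is "_ \<le> ?E + ?K")
  unfolding excess_def[of _ u]
proof (rule SUP_least)
  interpret Metric_space X d by fact
  fix p assume pu: "p \<in> u"
  obtain x \<alpha> where p: "p = (x, \<alpha>)"
    by fastforce
  have x: "x \<in> level_cut u 0" and \<alpha>: "0 \<le> \<alpha>"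
    using assms pu p by force+
  let ?D = "INF q\<in>v. ennreal (dbar d p q)"
  have base: "ennreal \<alpha> \<le> (INF q\<in>X \<times> {0}. ennreal (dbar d p q))"
    by (rule INF_greatest) (use \<alpha> in \<open>auto simp: p dbar_def intro!: ennreal_leI\<close>)
  have "min ?D (ennreal \<alpha>) \<le> inf ?D (INF q\<in>X \<times> {0}. ennreal (dbar d p q))"
    unfolding inf_min by (rule min.mono[OF order_refl base])
  also have "\<dots> = (INF q\<in>underline X v. ennreal (dbar d p q))"
    unfolding underline_def by (rule INF_union[symmetric])
  also have "\<dots> \<le> ?E"
    by (rule INF_le_excess) (simp add: underline_def pu)
  finally consider "?D \<le> ?E" | "ennreal \<alpha> \<le> ?E"
    by (auto simp: min_le_iff_disj)
  then show "?D \<le> ?E + ?K"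
  proof cases
    case 1
    then show ?thesis
      by (simp add: add_increasing2)
  next
    case 2
    have "?D - ennreal \<alpha> \<le> (INF y\<in>level_cut v 0. ennreal (d x y))"
    proof (rule INF_greatest)
      fix y assume "y \<in> level_cut v 0"
      then have "?D \<le> ennreal (dbar d p (y, 0))"
        by (intro INF_lower) (simp add: level_cut_def)
      also have "\<dots> = ennreal \<alpha> + ennreal (d x y)"
        using \<alpha> by (simp add: p dbar_def add.commute flip: ennreal_plus)
      finally show "?D - ennreal \<alpha> \<le> ennreal (d x y)"
        by (simp add: ennreal_minus_le_iff)
    qed
    then have "?D \<le> ennreal \<alpha> + (INF y\<in>level_cut v 0. ennreal (d x y))"
      by (simp add: ennreal_minus_le_iff)
    also have "\<dots> \<le> ?E + ?K"
      by (rule add_mono[OF 2 INF_le_excess[OF x]])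
    finally show ?thesis .
  qed
qed

section \<open>Comparing the sendograph and endograph distances\<close>

context
  fixes X :: "'a set" and d :: "'a \<Rightarrow> 'a \<Rightarrow> real"
  assumes metric: "Metric_space X d"
begin

lemma hausdorff_max_excess:
  shows "hausdorff d A B = max (excess d A B) (excess d B A)"
    and "hausdorff (dbar d) S T = max (excess (dbar d) S T) (excess (dbar d) T S)"
  using Metric_space.commute[OF metric] Metric_space.commute[OF Metric_space_dbar[OF metric]]
  by (auto intro: hausdorff_eq_max_excess)

lemma H_end_le_H_send: "H_end X d u v \<le> H_send d u v"
  unfolding H_end_def H_send_def hausdorff_max_excess
  by (intro max.mono excess_end_le_send metric)

lemma hausdorff_cut_le_H_send:
  assumes "u \<in> P1_USC X d" and "v \<in> P1_USC X d"
  shows "hausdorff d (level_cut u 0) (level_cut v 0) \<le> H_send d u v"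
  unfolding H_send_def hausdorff_max_excess
  by (intro max.mono excess_cut_le_send P1_USC_fst_subset_cut[OF assms(1)]
      P1_USC_fst_subset_cut[OF assms(2)])

lemma H_send_le_H_end_plus_cut:
  assumes "u \<in> P1_USC X d" and "v \<in> P1_USC X d"
  shows "H_send d u v \<le> H_end X d u v + hausdorff d (level_cut u 0) (level_cut v 0)"
proof -
  note bound = excess_send_le[OF metric P1_USC_subset P1_USC_fst_subset_cut]
  show ?thesis
    unfolding H_send_def H_end_def hausdorff_max_excess
    by (intro max.boundedI order_trans[OF bound[OF assms(1) assms(1)]]
        order_trans[OF bound[OF assms(2) assms(2)]] add_mono) auto
qed

lemma H_send_tendsto_zero_iff:
  assumes U: "\<And>n. U n \<in> P1_USC X d" and u: "u \<in> P1_USC X d"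
  shows "(\<lambda>n. H_send d (U n) u) \<longlonglongrightarrow> 0 \<longleftrightarrow>
    (\<lambda>n. H_end X d (U n) u) \<longlonglongrightarrow> 0 \<and>
    (\<lambda>n. hausdorff d (level_cut (U n) 0) (level_cut u 0)) \<longlonglongrightarrow> 0"
    (is "?S \<longlonglongrightarrow> 0 \<longleftrightarrow> ?E \<longlonglongrightarrow> 0 \<and> ?K \<longlonglongrightarrow> 0")
proof (intro iffI conjI)
  assume S: "?S \<longlonglongrightarrow> 0"
  show "?E \<longlonglongrightarrow> 0"
    by (rule tendsto_sandwich[OF _ _ tendsto_const S]) (simp_all add: H_end_le_H_send)
  show "?K \<longlonglongrightarrow> 0"
    by (rule tendsto_sandwich[OF _ _ tendsto_const S]) (simp_all add: hausdorff_cut_le_H_send U u)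
next
  assume "?E \<longlonglongrightarrow> 0 \<and> ?K \<longlonglongrightarrow> 0"
  then have sum: "(\<lambda>n. ?E n + ?K n) \<longlonglongrightarrow> 0"
    using tendsto_add[of ?E 0 sequentially ?K 0] by simp
  show "?S \<longlonglongrightarrow> 0"
    by (rule tendsto_sandwich[OF _ _ tendsto_const sum])
      (simp_all add: H_send_le_H_end_plus_cut U u)
qed

section \<open>Kuratowski convergence\<close>

lemma limitin_dbar_iff:
  assumes "\<And>n. s n \<in> X \<times> {0..1}"
  shows "limitin (Metric_space.mtopology (X \<times> {0..1}) (dbar d)) s p sequentially \<longleftrightarrow>
    limitin (Metric_space.mtopology X d) (\<lambda>n. fst (s n)) (fst p) sequentially \<and>
    snd p \<in> {0..1} \<and> (\<lambda>n. snd (s n)) \<longlonglongrightarrow> snd p"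
proof -
  interpret M: Metric_space X d by (rule metric)
  interpret D: Metric_space "X \<times> {0..1}" "dbar d" by (rule Metric_space_dbar[OF metric])
  have coords: "(\<lambda>n. dbar d (s n) p) \<longlonglongrightarrow> 0 \<longleftrightarrow>
    (\<lambda>n. d (fst (s n)) (fst p)) \<longlonglongrightarrow> 0 \<and> (\<lambda>n. snd (s n)) \<longlonglongrightarrow> snd p"
  proof
    assume lim: "(\<lambda>n. dbar d (s n) p) \<longlonglongrightarrow> 0"
    have "(\<lambda>n. d (fst (s n)) (fst p)) \<longlonglongrightarrow> 0"
      by (rule tendsto_sandwich[OF _ _ tendsto_const lim]) (simp_all add: dbar_def)
    moreover have "(\<lambda>n. \<bar>snd (s n) - snd p\<bar>) \<longlonglongrightarrow> 0"
      by (rule tendsto_sandwich[OF _ _ tendsto_const lim]) (simp_all add: dbar_def)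
    then have "(\<lambda>n. snd (s n)) \<longlonglongrightarrow> snd p"
      by (simp add: LIM_zero_iff tendsto_rabs_zero_iff)
    ultimately show "(\<lambda>n. d (fst (s n)) (fst p)) \<longlonglongrightarrow> 0 \<and> (\<lambda>n. snd (s n)) \<longlonglongrightarrow> snd p"
      by simp
  next
    assume "(\<lambda>n. d (fst (s n)) (fst p)) \<longlonglongrightarrow> 0 \<and> (\<lambda>n. snd (s n)) \<longlonglongrightarrow> snd p"
    moreover from this have "(\<lambda>n. \<bar>snd (s n) - snd p\<bar>) \<longlonglongrightarrow> 0"
      by (simp add: LIM_zero_iff tendsto_rabs_zero_iff)
    ultimately show "(\<lambda>n. dbar d (s n) p) \<longlonglongrightarrow> 0"
      unfolding dbar_def using tendsto_add_zero by blast
  qed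
  have "fst (s n) \<in> X" for n
    using assms[of n] by auto
  then show ?thesis
    using assms by (auto simp: M.limitin_metric_dist_null D.limitin_metric_dist_null coords
        mem_Times_iff)
qed

lemma limitin_dbar_zero_height:
  assumes "\<And>n. x n \<in> X"
    and "limitin (Metric_space.mtopology X d) x l sequentially"
  shows "limitin (Metric_space.mtopology (X \<times> {0..1}) (dbar d)) (\<lambda>n. (x n, 0)) (l, 0) sequentially"
  using assms by (subst limitin_dbar_iff) auto

text \<open>The lower limit is contained in the upper one: take the whole sequence as subsequence.\<close>
lemma K_converges_iff_subsets:
  "K_converges Y \<rho> C L \<longleftrightarrow> L \<subseteq> K_liminf Y \<rho> C \<and> K_limsup Y \<rho> C \<subseteq> L"
proof -
  have "K_liminf Y \<rho> C \<subseteq> K_limsup Y \<rho> C"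
    unfolding K_liminf_def K_limsup_def by (blast intro: strict_mono_id[unfolded id_def])
  then show ?thesis
    unfolding K_converges_def by blast
qed

lemma K_liminfI:
  "(\<And>n. s n \<in> C n) \<Longrightarrow> limitin (Metric_space.mtopology Y \<rho>) s x sequentially
    \<Longrightarrow> x \<in> K_liminf Y \<rho> C"
  unfolding K_liminf_def by blast

lemma K_limsupI:
  "strict_mono r \<Longrightarrow> (\<And>j. s j \<in> C (r j))
    \<Longrightarrow> limitin (Metric_space.mtopology Y \<rho>) s x sequentially \<Longrightarrow> x \<in> K_limsup Y \<rho> C"
  unfolding K_limsup_def by blast

lemma underline_subset:
  "u \<subseteq> X \<times> {0..1} \<Longrightarrow> underline X u \<subseteq> X \<times> {0..1}"
  by (auto simp: underline_def)

text \<open>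
  The added points have height \<open>0\<close> and cannot approach a point of positive height.
\<close>
lemma eventually_in_of_positive_height:
  assumes sub: "\<And>n. C n \<subseteq> X \<times> {0..1}" and s: "\<And>n. s n \<in> underline X (C n)"
    and lim: "limitin (Metric_space.mtopology (X \<times> {0..1}) (dbar d)) s p sequentially"
    and pos: "0 < snd p"
  shows "\<forall>\<^sub>F n in sequentially. s n \<in> C n"
proof -
  have "s n \<in> X \<times> {0..1}" for n
    using underline_subset[OF sub] s by blast
  with lim have "(\<lambda>n. snd (s n)) \<longlonglongrightarrow> snd p"
    by (simp add: limitin_dbar_iff)
  then have "\<forall>\<^sub>F n in sequentially. 0 < snd (s n)"
    using pos by (rule order_tendstoD)
  then show ?thesis
  proof eventually_elim
    case (elim n)
    then show ?case
      using s[of n] by (auto simp: underline_def)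
  qed
qed

lemma limitin_fst:
  assumes "\<And>n. C n \<subseteq> X \<times> {0..1}" and "\<And>n. s n \<in> C n"
    and "limitin (Metric_space.mtopology (X \<times> {0..1}) (dbar d)) s p sequentially"
  shows "limitin (Metric_space.mtopology X d) (\<lambda>n. fst (s n)) (fst p) sequentially"
proof -
  have "s n \<in> X \<times> {0..1}" for n
    using assms(1,2) by blast
  with assms(3) show ?thesis
    by (simp add: limitin_dbar_iff)
qed

context
  fixes U :: "nat \<Rightarrow> ('a \<times> real) set" and u :: "('a \<times> real) set"
  assumes sub: "\<And>n. U n \<subseteq> X \<times> {0..1}" "u \<subseteq> X \<times> {0..1}"
    and base: "\<And>n. fst ` U n \<subseteq> level_cut (U n) 0"
begin

lemma K_converges_underline:
  assumes "K_converges (X \<times> {0..1}) (dbar d) U u"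
  shows "K_converges (X \<times> {0..1}) (dbar d) (\<lambda>n. underline X (U n)) (underline X u)"
  unfolding K_converges_iff_subsets
proof (intro conjI subsetI)
  interpret D: Metric_space "X \<times> {0..1}" "dbar d" by (rule Metric_space_dbar[OF metric])
  from assms have lower: "u \<subseteq> K_liminf (X \<times> {0..1}) (dbar d) U"
    and upper: "K_limsup (X \<times> {0..1}) (dbar d) U \<subseteq> u"
    by (simp_all add: K_converges_iff_subsets)
  fix p
  {
    assume "p \<in> underline X u"
    then consider "p \<in> u" | "p \<in> X \<times> {0}"
      by (auto simp: underline_def)
    then show "p \<in> K_liminf (X \<times> {0..1}) (dbar d) (\<lambda>n. underline X (U n))"
    proof cases
      case 1
      then show ?thesis
        using lower unfolding K_liminf_def underline_def by blast
    next
      case 2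
      then have "limitin D.mtopology (\<lambda>n. p) p sequentially"
        by auto
      with 2 show ?thesis
        by (intro K_liminfI[of "\<lambda>n. p"]) (auto simp: underline_def)
    qed
  next
    assume "p \<in> K_limsup (X \<times> {0..1}) (dbar d) (\<lambda>n. underline X (U n))"
    then obtain r s where r: "strict_mono r" and s: "\<And>j. s j \<in> underline X (U (r j))"
      and lim: "limitin D.mtopology s p sequentially"
      unfolding K_limsup_def by blast
    have p: "p \<in> X \<times> {0..1}"
      using lim D.limitin_mspace by blast
    show "p \<in> underline X u"
    proof (cases "snd p = 0")
      case True
      with p show ?thesis
        by (auto simp: underline_def)
    next
      case False
      with p have "0 < snd p"
        by auto
      from eventually_in_of_positive_height[OF sub(1) s lim this]
      obtain N where N: "\<And>j. j \<ge> N \<Longrightarrow> s j \<in> U (r j)"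
        unfolding eventually_sequentially by blast
      \<comment> \<open>Discarding the first \<open>N\<close> terms leaves a subsequence inside the sets \<open>U n\<close>.\<close>
      have "p \<in> K_limsup (X \<times> {0..1}) (dbar d) U"
      proof (rule K_limsupI)
        show "strict_mono (\<lambda>j. r (j + N))"
          using r by (simp add: strict_mono_def)
        show "s (j + N) \<in> U (r (j + N))" for j
          by (simp add: N)
        show "limitin D.mtopology (\<lambda>j. s (j + N)) p sequentially"
          using lim by (simp add: limitin_sequentially_offset)
      qed
      then show ?thesis
        using upper by (auto simp: underline_def)
    qed
  }
qed

lemma K_converges_cut:
  assumes "K_converges (X \<times> {0..1}) (dbar d) U u"
  shows "K_converges X d (\<lambda>n. level_cut (U n) 0) (level_cut u 0)"
  unfolding K_converges_iff_subsets
proof (intro conjI subsetI)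
  from assms have lower: "u \<subseteq> K_liminf (X \<times> {0..1}) (dbar d) U"
    and upper: "K_limsup (X \<times> {0..1}) (dbar d) U \<subseteq> u"
    by (simp_all add: K_converges_iff_subsets)
  fix x
  {
    assume "x \<in> level_cut u 0"
    then have "(x, 0) \<in> K_liminf (X \<times> {0..1}) (dbar d) U"
      using lower by (auto simp: level_cut_def)
    then obtain s where s: "\<And>n. s n \<in> U n"
      and lim: "limitin (Metric_space.mtopology (X \<times> {0..1}) (dbar d)) s (x, 0) sequentially"
      unfolding K_liminf_def by blast
    have "fst (s n) \<in> level_cut (U n) 0" for n
      using base s by blast
    moreover have "limitin (Metric_space.mtopology X d) (\<lambda>n. fst (s n)) x sequentially"
      using limitin_fst[OF sub(1) s lim] by simp
    ultimately show "x \<in> K_liminf X d (\<lambda>n. level_cut (U n) 0)"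
      by (rule K_liminfI)
  next
    assume "x \<in> K_limsup X d (\<lambda>n. level_cut (U n) 0)"
    then obtain r s where r: "strict_mono r" and s: "\<And>j. s j \<in> level_cut (U (r j)) 0"
      and lim: "limitin (Metric_space.mtopology X d) s x sequentially"
      unfolding K_limsup_def by blast
    have "s j \<in> X" for j
      using level_cut_zero_subset[OF sub(1)] s by blast
    then have "limitin (Metric_space.mtopology (X \<times> {0..1}) (dbar d)) (\<lambda>j. (s j, 0)) (x, 0)
        sequentially"
      using lim by (rule limitin_dbar_zero_height)
    with r s have "(x, 0) \<in> K_limsup (X \<times> {0..1}) (dbar d) U"
      by (intro K_limsupI[of r "\<lambda>j. (s j, 0)"]) (auto simp: level_cut_def)
    then show "x \<in> level_cut u 0"
      using upper by (auto simp: level_cut_def)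
  }
qed

text \<open>
  A point of \<open>u\<close> is approximated from the endographs if it has positive height, and from the bottom
  cuts if it has height \<open>0\<close>. A cluster point of the sets that the endograph limit does not
  already place in \<open>u\<close> has height \<open>0\<close>, and is then placed there by the limit of the bottom cuts.
\<close>
lemma K_converges_of_underline_cut:
  assumes ends: "K_converges (X \<times> {0..1}) (dbar d) (\<lambda>n. underline X (U n)) (underline X u)"
    and cuts: "K_converges X d (\<lambda>n. level_cut (U n) 0) (level_cut u 0)"
    and nonempty: "\<And>n. U n \<noteq> {}"
  shows "K_converges (X \<times> {0..1}) (dbar d) U u"
  unfolding K_converges_iff_subsets
proof (intro conjI subsetI)
  interpret D: Metric_space "X \<times> {0..1}" "dbar d" by (rule Metric_space_dbar[OF metric])
  fix p
  {
    assume pu: "p \<in> u"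
    show "p \<in> K_liminf (X \<times> {0..1}) (dbar d) U"
    proof (cases "snd p = 0")
      case True
      then have "fst p \<in> K_liminf X d (\<lambda>n. level_cut (U n) 0)"
        using pu cuts by (cases p) (auto simp: K_converges_def level_cut_def)
      then obtain s where s: "\<And>n. s n \<in> level_cut (U n) 0"
        and lim: "limitin (Metric_space.mtopology X d) s (fst p) sequentially"
        unfolding K_liminf_def by blast
      have "s n \<in> X" for n
        using level_cut_zero_subset[OF sub(1)] s by blast
      then have "limitin D.mtopology (\<lambda>n. (s n, 0)) (fst p, 0) sequentially"
        using lim by (rule limitin_dbar_zero_height)
      with True have "limitin D.mtopology (\<lambda>n. (s n, 0)) p sequentially"
        by (cases p) simp
      with s show ?thesis
        by (intro K_liminfI[of "\<lambda>n. (s n, 0)"]) (auto simp: level_cut_def)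
    next
      case False
      with pu sub(2) have pos: "0 < snd p"
        by force
      have "p \<in> K_liminf (X \<times> {0..1}) (dbar d) (\<lambda>n. underline X (U n))"
        using pu ends by (auto simp: K_converges_def underline_def)
      then obtain s where s: "\<And>n. s n \<in> underline X (U n)"
        and lim: "limitin D.mtopology s p sequentially"
        unfolding K_liminf_def by blast
      \<comment> \<open>The finitely many terms outside \<open>U n\<close> are replaced by arbitrary points of \<open>U n\<close>.\<close>
      define t where "t n = (if s n \<in> U n then s n else SOME q. q \<in> U n)" for n
      have "t n \<in> U n" for n
        using nonempty[of n] by (simp add: t_def some_in_eq)
      moreover have "\<forall>\<^sub>F n in sequentially. s n = t n"
        using eventually_in_of_positive_height[OF sub(1) s lim pos]
        by eventually_elim (simp add: t_def)
      then have "limitin D.mtopology t p sequentially"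
        using lim by (rule limitin_transform_eventually)
      ultimately show ?thesis
        by (rule K_liminfI)
    qed
  next
    assume "p \<in> K_limsup (X \<times> {0..1}) (dbar d) U"
    then obtain r s where r: "strict_mono r" and s: "\<And>j. s j \<in> U (r j)"
      and lim: "limitin D.mtopology s p sequentially"
      unfolding K_limsup_def by blast
    have "p \<in> K_limsup (X \<times> {0..1}) (dbar d) (\<lambda>n. underline X (U n))"
      using r s lim by (intro K_limsupI[of r s]) (auto simp: underline_def)
    then have "p \<in> underline X u"
      using ends unfolding K_converges_def by blast
    then consider "p \<in> u" | "snd p = 0"
      by (auto simp: underline_def)
    then show "p \<in> u"
    proof cases
      case 2
      have "fst (s j) \<in> level_cut (U (r j)) 0" for j
        using base s by blast
      then have "fst p \<in> K_limsup X d (\<lambda>n. level_cut (U n) 0)"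
        using r limitin_fst[OF sub(1) s lim] by (intro K_limsupI[of r "\<lambda>j. fst (s j)"]) auto
      then have "fst p \<in> level_cut u 0"
        using cuts unfolding K_converges_def by blast
      with 2 show ?thesis
        by (cases p) (simp add: level_cut_def)
    qed
  }
qed

end

lemma K_converges_iff_underline_cut:
  assumes U: "\<And>n. U n \<in> P1_USC X d" and u: "u \<in> P1_USC X d"
  shows "K_converges (X \<times> {0..1}) (dbar d) U u \<longleftrightarrow>
    K_converges (X \<times> {0..1}) (dbar d) (\<lambda>n. underline X (U n)) (underline X u) \<and>
    K_converges X d (\<lambda>n. level_cut (U n) 0) (level_cut u 0)"
proof -
  note facts = P1_USC_subset[OF U] P1_USC_subset[OF u] P1_USC_fst_subset_cut[OF U]
  have "U n \<noteq> {}" for n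
    using P1_USC_cut_nonempty[OF U] by (auto simp: level_cut_def)
  then show ?thesis
    using K_converges_underline[of U u, OF facts] K_converges_cut[of U u, OF facts]
      K_converges_of_underline_cut[of U u, OF facts] by blast
qed

end

theorem theorem3p2:
  fixes X :: "'a set" and d :: "'a \<Rightarrow> 'a \<Rightarrow> real"
  assumes "Metric_space X d" and "X \<noteq> {}"
  shows
    "(\<forall>u\<in>P1_USC X d. \<forall>v\<in>P1_USC X d.
        H_end X d u v \<le> H_send d u v \<and>
        hausdorff d (level_cut u 0) (level_cut v 0) \<le> H_send d u v \<and>
        (H_end X d u v < 1 \<longrightarrow>
           H_send d u v \<le> H_end X d u v + hausdorff d (level_cut u 0) (level_cut v 0))) \<and>
     (\<forall>(U :: nat \<Rightarrow> ('a \<times> real) set) u.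
        (\<forall>n. U n \<in> P1_USC X d) \<and> u \<in> P1_USC X d \<longrightarrow>
        ((\<lambda>n. H_send d (U n) u) \<longlonglongrightarrow> 0 \<longleftrightarrow>
           (\<lambda>n. H_end X d (U n) u) \<longlonglongrightarrow> 0 \<and>
           (\<lambda>n. hausdorff d (level_cut (U n) 0) (level_cut u 0)) \<longlonglongrightarrow> 0) \<and>
        (K_converges (X \<times> {0..1}) (dbar d) U u \<longleftrightarrow>
           K_converges (X \<times> {0..1}) (dbar d) (\<lambda>n. underline X (U n)) (underline X u) \<and>
           K_converges X d (\<lambda>n. level_cut (U n) 0) (level_cut u 0)))"
  using H_end_le_H_send[OF assms(1)] hausdorff_cut_le_H_send[OF assms(1)]
    H_send_le_H_end_plus_cut[OF assms(1)] H_send_tendsto_zero_iff[OF assms(1)]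
    K_converges_iff_underline_cut[OF assms(1)]
  by (intro conjI ballI allI impI) simp_all

end
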